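(* Let $\mathcal A\subseteq\mathbb N$, $n\in\mathbb N$, $L$ an environment and $T,T_1,T_2$ terms. If $L\vdash_{\mathcal A}T$, $L\vdash T\to^{*n}T_1$ with $T_1$ r-normal in $L$, and $L\vdash T\to^{*n}T_2$ with $T_2$ r-normal in $L$, then $T_1=T_2$.
   Context: Fix a nonempty set $\Sigma$ of sorts with decidable equality, an arbitrary function $\mathrm{next}:\Sigma\to\Sigma$, and a countably infinite set of variables. Terms and environments: $T,U,V,W ::= \star s \mid x \mid \mathrm{app}(V,T) \mid \lambda x{:}W.\,T \mid \mathrm{def}(x{=}V).\,T \mid \mathrm{cast}(U,T)$ ($s\in\Sigma$) and $L,K ::= \emptyset \mid K,x{:}W \mid K,x{=}V$. $\mathrm{app}(V,T)$ applies $T$ to $V$; $\lambda x{:}W.\,T$ (de Bruijn's abstraction) and $\mathrm{def}(x{=}V).\,T$ (local definition) bind $x$ in $T$; $\mathrm{cast}(U,T)$ annotates $T$ with expected type $U$; entries $x{:}W$ and $x{=}V$ bind $x$. Terms are modulo renaming of bound variables (equality of terms is equality up to this renaming). Write $\mathsf{B}x[V]$ for either $\lambda x{:}V$ or $\mathrm{def}(x{=}V)$ and correspondingly $L,x[V]$ for $L,x{:}V$ resp. $L,x{=}V$. One step of bound rt-reduction $L\vdash T_1\to^nT_2$ is the smallest relation closed under: $L\vdash\mathrm{app}(V,\lambda x{:}W.\,T)\to^0\mathrm{def}(x{=}\mathrm{cast}(W,V)).\,T$; $K,x{=}V\vdash x\to^0V$; $L\vdash\mathrm{def}(x{=}V).\,T\to^0T$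 if $x$ not free in $T$; $L\vdash\mathrm{app}(V,\mathrm{def}(x{=}W).\,T)\to^0\mathrm{def}(x{=}W).\,\mathrm{app}(V,T)$; $L\vdash\mathrm{cast}(U,T)\to^0T$; $L\vdash\star s\to^1\star\,\mathrm{next}(s)$; $K,x{:}W\vdash x\to^1W$; $L\vdash\mathrm{cast}(U,T)\to^1U$; if $K\vdash x\to^nT$, $y\neq x$, $y$ not free in $T$ then $K,y[V]\vdash x\to^nT$; if $L\vdash V_1\to^0V_2$ then $L\vdash\mathrm{app}(V_1,T)\to^0\mathrm{app}(V_2,T)$; if $L\vdash T_1\to^nT_2$ then $L\vdash\mathrm{app}(V,T_1)\to^n\mathrm{app}(V,T_2)$; if $L\vdash V_1\to^0V_2$ then $L\vdash\mathsf Bx[V_1].\,T\to^0\mathsf Bx[V_2].\,T$; if $L,x[V]\vdash T_1\to^nT_2$ then $L\vdash\mathsf Bx[V].\,T_1\to^n\mathsf Bx[V].\,T_2$; if $L\vdash U_1\to^0U_2$ then $L\vdash\mathrm{cast}(U_1,T)\to^0\mathrm{cast}(U_2,T)$; if $L\vdash T_1\to^0T_2$ then $L\vdash\mathrm{cast}(U,T_1)\to^0\mathrm{cast}(U,T_2)$; if $L\vdash U_1\to^1U_2$ and $L\vdash T_1\to^1T_2$ then $L\vdash\mathrm{cast}(U_1,T_1)\to^1\mathrm{cast}(U_2,T_2)$. $L\vdash T_1\to^{*n}T_2$ is the smallest relation with $L\vdash T\to^{*0}T$, containing single steps, and with $L\vdash T_1\to^{*n_1}T$, $L\vdash T\to^{*n_2}T_2$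 implying $L\vdash T_1\to^{*n_1+n_2}T_2$. A term $T$ is r-normal in $L$ if every $T'$ with $L\vdash T\to^{*0}T'$ equals $T$. Validity $L\vdash_{\mathcal A}T$ is the smallest predicate closed under: $L\vdash_{\mathcal A}\star s$; if $K\vdash_{\mathcal A}V$ then $K,x[V]\vdash_{\mathcal A}x$; if $K\vdash_{\mathcal A}x$ and $y\neq x$ then $K,y[V]\vdash_{\mathcal A}x$; if $L\vdash_{\mathcal A}V$ and $L,x[V]\vdash_{\mathcal A}T$ then $L\vdash_{\mathcal A}\mathsf Bx[V].\,T$; if $L\vdash_{\mathcal A}U$, $L\vdash_{\mathcal A}T$ and some $U_0$ satisfies $L\vdash T\to^{*1}U_0$, $L\vdash U\to^{*0}U_0$, then $L\vdash_{\mathcal A}\mathrm{cast}(U,T)$; if $L\vdash_{\mathcal A}V$, $L\vdash_{\mathcal A}T$ and there are $n\in\mathcal A$, $x,W_0,U_0$ with $L\vdash T\to^{*n}\lambda x{:}W_0.\,U_0$ and $L\vdash V\to^{*1}W_0$, then $L\vdash_{\mathcal A}\mathrm{app}(V,T)$. *)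

theory Defs
  imports Main
begin

(*
  Terms modulo renaming of bound variables are represented with de Bruijn indices.
  The sorts form the type 's. Environments bind variables too: an environment is a list
  whose head is its most recent (rightmost) entry, and in "L |- T" the variable Var i of T
  refers to the i-th entry of L. Entries may be mentioned only by what follows them, so the
  term of an entry lives in the tail behind it. Indices i >= length L are the (countably many)
  variables not declared in L; environments and terms need not be closed.
*)

datatype bkind = Lam | Def

datatype 's trm =
    Sort 's
  | Var nat
  | App "'s trm" "'s trm"           (* App V T applies T to V *)
  | Bind bkind "'s trm" "'s trm"   (* Bind Lam W T = (\<lambda>x:W. T), Bind Def V T = def(x=V). T *)
  | Cast "'s trm" "'s trm"          (* Cast U T annotates T with expected type U *)

type_synonym 's env = "(bkind \<times> 's trm) list"

(*
  lift k T makes room for a new variable with index k. The terms in which variable 0 does not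
  occur free are exactly those of the form lift 0 T; in named notation lift 0 T is the same
  term T, regarded under one more binder whose variable is not free in it.
*)
primrec lift :: "nat \<Rightarrow> 's trm \<Rightarrow> 's trm" where
  "lift k (Sort s) = Sort s"
| "lift k (Var i) = Var (if i < k then i else Suc i)"
| "lift k (App V T) = App (lift k V) (lift k T)"
| "lift k (Bind b V T) = Bind b (lift k V) (lift (Suc k) T)"
| "lift k (Cast U T) = Cast (lift k U) (lift k T)"

inductive rt_step :: "('s \<Rightarrow> 's) \<Rightarrow> 's env \<Rightarrow> nat \<Rightarrow> 's trm \<Rightarrow> 's trm \<Rightarrow> bool"
  for nxt :: "'s \<Rightarrow> 's" where
  beta: "rt_step nxt L 0 (App V (Bind Lam W T)) (Bind Def (Cast W V) T)"
| delta: "rt_step nxt ((Def, V) # K) 0 (Var 0) (lift 0 V)"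
| zeta: "rt_step nxt L 0 (Bind Def V (lift 0 T)) T"
| theta: "rt_step nxt L 0 (App V (Bind Def W T)) (Bind Def W (App (lift 0 V) T))"
| eps: "rt_step nxt L 0 (Cast U T) T"
| sort: "rt_step nxt L 1 (Sort s) (Sort (nxt s))"
| decl: "rt_step nxt ((Lam, W) # K) 1 (Var 0) (lift 0 W)"
| ety: "rt_step nxt L 1 (Cast U T) U"
| var: "rt_step nxt K n (Var i) T \<Longrightarrow> rt_step nxt ((b, V) # K) n (Var (Suc i)) (lift 0 T)"
| app_arg: "rt_step nxt L 0 V1 V2 \<Longrightarrow> rt_step nxt L 0 (App V1 T) (App V2 T)"
| app_fun: "rt_step nxt L n T1 T2 \<Longrightarrow> rt_step nxt L n (App V T1) (App V T2)"
| bind_arg: "rt_step nxt L 0 V1 V2 \<Longrightarrow> rt_step nxt L 0 (Bind b V1 T) (Bind b V2 T)"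
| bind_body: "rt_step nxt ((b, V) # L) n T1 T2 \<Longrightarrow> rt_step nxt L n (Bind b V T1) (Bind b V T2)"
| cast_ty: "rt_step nxt L 0 U1 U2 \<Longrightarrow> rt_step nxt L 0 (Cast U1 T) (Cast U2 T)"
| cast_tm: "rt_step nxt L 0 T1 T2 \<Longrightarrow> rt_step nxt L 0 (Cast U T1) (Cast U T2)"
| cast_both: "rt_step nxt L 1 U1 U2 \<Longrightarrow> rt_step nxt L 1 T1 T2
    \<Longrightarrow> rt_step nxt L 1 (Cast U1 T1) (Cast U2 T2)"

inductive rt_steps :: "('s \<Rightarrow> 's) \<Rightarrow> 's env \<Rightarrow> nat \<Rightarrow> 's trm \<Rightarrow> 's trm \<Rightarrow> bool"
  for nxt :: "'s \<Rightarrow> 's" where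
  refl: "rt_steps nxt L 0 T T"
| step: "rt_step nxt L n T1 T2 \<Longrightarrow> rt_steps nxt L n T1 T2"
| trans: "rt_steps nxt L n1 T1 T \<Longrightarrow> rt_steps nxt L n2 T T2 \<Longrightarrow> rt_steps nxt L (n1 + n2) T1 T2"

definition r_normal :: "('s \<Rightarrow> 's) \<Rightarrow> 's env \<Rightarrow> 's trm \<Rightarrow> bool" where
  "r_normal nxt L T \<longleftrightarrow> (\<forall>T'. rt_steps nxt L 0 T T' \<longrightarrow> T' = T)"

inductive valid :: "('s \<Rightarrow> 's) \<Rightarrow> nat set \<Rightarrow> 's env \<Rightarrow> 's trm \<Rightarrow> bool"
  for nxt :: "'s \<Rightarrow> 's" and A :: "nat set" where
  sort: "valid nxt A L (Sort s)"
| var_0: "valid nxt A K V \<Longrightarrow> valid nxt A ((b, V) # K) (Var 0)"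
| var_Suc: "valid nxt A K (Var i) \<Longrightarrow> valid nxt A ((b, V) # K) (Var (Suc i))"
| bind: "valid nxt A L V \<Longrightarrow> valid nxt A ((b, V) # L) T \<Longrightarrow> valid nxt A L (Bind b V T)"
| cast: "valid nxt A L U \<Longrightarrow> valid nxt A L T
    \<Longrightarrow> rt_steps nxt L 1 T U0 \<Longrightarrow> rt_steps nxt L 0 U U0
    \<Longrightarrow> valid nxt A L (Cast U T)"
| app: "valid nxt A L V \<Longrightarrow> valid nxt A L T
    \<Longrightarrow> n \<in> A \<Longrightarrow> rt_steps nxt L n T (Bind Lam W0 U0) \<Longrightarrow> rt_steps nxt L 1 V W0
    \<Longrightarrow> valid nxt A L (App V T)"

end

theory Submission
  imports Defs "HOL-Library.Confluence"
begin

text \<open>Unfolding all definitions turns a term into a pure term, built without \<open>Def\<close>. On pure terms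
  there is a canonical type function \<open>ty\<close> that sends a cast to its annotation.
  Restrict the erasure of a cast \<open>PCast u t\<close> to the case that \<open>ty t\<close> and \<open>u\<close> are convertible, where
  conversion is the equivalence generated by the restricted reduction itself. The restricted
  reduction is confluent and \<open>ty\<close> respects conversion, for all terms and without any appeal to
  strong normalization. Hence validity, rephrased through conversion and iterates of \<open>ty\<close>, is
  preserved by reduction: on valid terms every erasure of a cast is a restricted one, and every
  n-fold typed reduct of \<open>t\<close> is convertible to the n-th iterate of \<open>ty\<close> on \<open>t\<close>. Two normal reducts
  of the same degree are then convertible, so equal by confluence.\<close>

section \<open>Pure terms, renamings and substitutions\<close>

datatype 's pterm =
    PSort 's
  | PVar nat
  | PApp "'s pterm" "'s pterm"
  | PLam "'s pterm" "'s pterm"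
  | PCast "'s pterm" "'s pterm"

fun up_ren :: "(nat \<Rightarrow> nat) \<Rightarrow> nat \<Rightarrow> nat" where
  "up_ren r 0 = 0"
| "up_ren r (Suc i) = Suc (r i)"

primrec ren :: "(nat \<Rightarrow> nat) \<Rightarrow> 's pterm \<Rightarrow> 's pterm" where
  "ren r (PSort s) = PSort s"
| "ren r (PVar i) = PVar (r i)"
| "ren r (PApp v t) = PApp (ren r v) (ren r t)"
| "ren r (PLam w t) = PLam (ren r w) (ren (up_ren r) t)"
| "ren r (PCast u t) = PCast (ren r u) (ren r t)"

fun scons :: "'a \<Rightarrow> (nat \<Rightarrow> 'a) \<Rightarrow> nat \<Rightarrow> 'a" where
  "scons a f 0 = a"
| "scons a f (Suc i) = f i"

definition up :: "(nat \<Rightarrow> 's pterm) \<Rightarrow> nat \<Rightarrow> 's pterm" where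
  "up f = scons (PVar 0) (\<lambda>i. ren Suc (f i))"

primrec sub :: "(nat \<Rightarrow> 's pterm) \<Rightarrow> 's pterm \<Rightarrow> 's pterm" where
  "sub f (PSort s) = PSort s"
| "sub f (PVar i) = f i"
| "sub f (PApp v t) = PApp (sub f v) (sub f t)"
| "sub f (PLam w t) = PLam (sub f w) (sub (up f) t)"
| "sub f (PCast u t) = PCast (sub f u) (sub f t)"

lemma up_0 [simp]: "up f 0 = PVar 0"
  and up_Suc [simp]: "up f (Suc i) = ren Suc (f i)"
  by (simp_all add: up_def)

lemma all_nat_split: "(\<forall>i. P i) \<longleftrightarrow> P 0 \<and> (\<forall>i. P (Suc i))"
  by (metis not0_implies_Suc)

lemma fun_eq_nat_split: "f = g \<longleftrightarrow> f 0 = g 0 \<and> (\<forall>i. f (Suc i) = g (Suc i))"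
  unfolding fun_eq_iff by (rule all_nat_split)

lemma ren_ren: "ren r (ren q t) = ren (\<lambda>i. r (q i)) t"
proof (induction t arbitrary: r q)
  case (PLam w t)
  have "(\<lambda>i. up_ren r (up_ren q i)) = up_ren (\<lambda>i. r (q i))"
    by (simp add: fun_eq_nat_split)
  with PLam show ?case by simp
qed auto

lemma sub_ren: "sub f (ren r t) = sub (\<lambda>i. f (r i)) t"
proof (induction t arbitrary: f r)
  case (PLam w t)
  have "(\<lambda>i. up f (up_ren r i)) = up (\<lambda>i. f (r i))"
    by (simp add: fun_eq_nat_split)
  with PLam show ?case by simp
qed auto

lemma ren_sub: "ren r (sub f t) = sub (\<lambda>i. ren r (f i)) t"
proof (induction t arbitrary: f r)
  case (PLam w t)
  have "(\<lambda>i. ren (up_ren r) (up f i)) = up (\<lambda>i. ren r (f i))"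
    by (simp add: fun_eq_nat_split ren_ren)
  with PLam show ?case by simp
qed auto

lemma sub_sub: "sub g (sub f t) = sub (\<lambda>i. sub g (f i)) t"
proof (induction t arbitrary: f g)
  case (PLam w t)
  have "(\<lambda>i. sub (up g) (up f i)) = up (\<lambda>i. sub g (f i))"
    by (simp add: fun_eq_nat_split sub_ren ren_sub)
  with PLam show ?case by simp
qed auto

lemma up_PVar [simp]: "up PVar = PVar"
  by (simp add: fun_eq_nat_split)

lemma sub_PVar [simp]: "sub PVar t = t"
  by (induction t) auto

abbreviation inst :: "'s pterm \<Rightarrow> 's pterm \<Rightarrow> 's pterm" where
  "inst a t \<equiv> sub (scons a PVar) t"

lemma inst_ren_Suc [simp]: "inst a (ren Suc t) = t"
  by (simp add: sub_ren)

lemma ren_inst: "ren r (inst a t) = inst (ren r a) (ren (up_ren r) t)"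
  unfolding ren_sub sub_ren
  by (rule arg_cong[where f = "\<lambda>f. sub f t"]) (simp add: fun_eq_nat_split)

lemma inst_sub_up: "inst a (sub (up f) t) = sub (scons a f) t"
  unfolding sub_sub
  by (rule arg_cong[where f = "\<lambda>f. sub f t"]) (simp add: fun_eq_nat_split sub_ren)

lemma sub_inst: "sub f (inst a t) = inst (sub f a) (sub (up f) t)"
  unfolding inst_sub_up unfolding sub_sub
  by (rule arg_cong[where f = "\<lambda>f. sub f t"]) (simp add: fun_eq_nat_split)

lemma up_ren_Suc: "ren (up_ren r) (ren Suc t) = ren Suc (ren r t)"
  by (simp add: ren_ren)

lemma sub_up_ren_Suc: "sub (up f) (ren Suc t) = ren Suc (sub f t)"
  by (simp add: sub_ren ren_sub)

section \<open>Contexts and canonical types\<close>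

type_synonym 's ctx = "nat \<Rightarrow> 's pterm"

text \<open>Entries are stored already lifted into the current scope, so looking up the type of a
  variable is plain application \<open>G i\<close>.\<close>

definition ext :: "'s pterm \<Rightarrow> 's ctx \<Rightarrow> 's ctx" where
  "ext w G = scons (ren Suc w) (\<lambda>i. ren Suc (G i))"

lemma ext_0 [simp]: "ext w G 0 = ren Suc w"
  and ext_Suc [simp]: "ext w G (Suc i) = ren Suc (G i)"
  by (simp_all add: ext_def)

primrec ty :: "('s \<Rightarrow> 's) \<Rightarrow> 's pterm \<Rightarrow> 's ctx \<Rightarrow> 's pterm" where
  "ty nxt (PSort s) G = PSort (nxt s)"
| "ty nxt (PVar i) G = G i"
| "ty nxt (PApp v t) G = PApp v (ty nxt t G)"
| "ty nxt (PLam w t) G = PLam w (ty nxt t (ext w G))"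
| "ty nxt (PCast u t) G = u"

lemma ext_ren: "\<forall>i. D (r i) = ren r (G i) \<Longrightarrow> \<forall>i. ext (ren r w) D (up_ren r i) = ren (up_ren r) (ext w G i)"
  by (subst all_nat_split) (simp add: up_ren_Suc)

lemma ty_ren: "\<forall>i. D (r i) = ren r (G i) \<Longrightarrow> ty nxt (ren r t) D = ren r (ty nxt t G)"
  by (induction t arbitrary: D r G) (auto simp: ext_ren)

lemma ty_ren_Suc: "ty nxt (ren Suc t) (ext w G) = ren Suc (ty nxt t G)"
  by (simp add: ty_ren)

lemma ext_sub:
  "\<forall>i. ty nxt (f i) D = sub f (G i) \<Longrightarrow>
    \<forall>i. ty nxt (up f i) (ext (sub f w) D) = sub (up f) (ext w G i)"
  by (subst all_nat_split) (simp add: sub_up_ren_Suc ty_ren_Suc)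

text \<open>\<open>ty\<close> never reduces anything, so it commutes with substitution up to
  equality as soon as the substituted terms have syntactically the types that the context
  prescribes. This keeps the side condition of \<open>par_eps\<close> stable under
  substitution.\<close>

lemma ty_sub: "\<forall>i. ty nxt (f i) D = sub f (G i) \<Longrightarrow> ty nxt (sub f t) D = sub f (ty nxt t G)"
  by (induction t arbitrary: D f G) (auto simp: ext_sub)

lemma ext_inst: "ty nxt a G = w \<Longrightarrow> \<forall>i. ty nxt (scons a PVar i) G = inst a (ext w G i)"
  by (subst all_nat_split) simp

text \<open>Contracting a beta redex inserts \<open>PCast w v\<close>, whose \<open>ty\<close> is
  \<open>w\<close> by definition, so the hypothesis then holds as an equality and not just up to
  conversion.\<close>

lemma ty_inst: "ty nxt a G = w \<Longrightarrow> ty nxt (inst a t) G = inst a (ty nxt t (ext w G))"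
  by (intro ty_sub ext_inst)

section \<open>Reduction with restricted erasure of casts\<close>

text \<open>Conversion occurs only positively in \<open>par_eps\<close>, so the two relations can be
  generated together; their stability properties are then proved by mutual induction. The side
  condition speaks of the unreduced source \<open>t\<close> and annotation \<open>u\<close>.\<close>

inductive par :: "('s \<Rightarrow> 's) \<Rightarrow> 's ctx \<Rightarrow> 's pterm \<Rightarrow> 's pterm \<Rightarrow> bool"
  and conv :: "('s \<Rightarrow> 's) \<Rightarrow> 's ctx \<Rightarrow> 's pterm \<Rightarrow> 's pterm \<Rightarrow> bool"
  for nxt :: "'s \<Rightarrow> 's" where
  par_sort: "par nxt G (PSort s) (PSort s)"
| par_var: "par nxt G (PVar i) (PVar i)"
| par_app: "par nxt G v v' \<Longrightarrow> par nxt G t t' \<Longrightarrow> par nxt G (PApp v t) (PApp v' t')"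
| par_lam: "par nxt G w w' \<Longrightarrow> par nxt (ext w G) t t' \<Longrightarrow> par nxt G (PLam w t) (PLam w' t')"
| par_cast: "par nxt G u u' \<Longrightarrow> par nxt G t t' \<Longrightarrow> par nxt G (PCast u t) (PCast u' t')"
| par_beta: "par nxt G v v' \<Longrightarrow> par nxt G w w' \<Longrightarrow> par nxt (ext w G) t t'
    \<Longrightarrow> par nxt G (PApp v (PLam w t)) (inst (PCast w' v') t')"
| par_eps: "conv nxt G (ty nxt t G) u \<Longrightarrow> par nxt G t t' \<Longrightarrow> par nxt G (PCast u t) t'"
| conv_par: "par nxt G t u \<Longrightarrow> conv nxt G t u"
| conv_sym: "conv nxt G t u \<Longrightarrow> conv nxt G u t"
| conv_trans: "conv nxt G t u \<Longrightarrow> conv nxt G u v \<Longrightarrow> conv nxt G t v"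

declare conv_trans [trans]

inductive_cases par_sortE: "par nxt G (PSort s) x"
inductive_cases par_varE: "par nxt G (PVar i) x"
inductive_cases par_appE: "par nxt G (PApp v t) x"
inductive_cases par_lamE: "par nxt G (PLam w t) x"
inductive_cases par_castE: "par nxt G (PCast u t) x"

lemma par_refl [simp]: "par nxt G t t"
  by (induction t arbitrary: G) (auto intro: par_conv.intros)

lemma conv_refl [simp]: "conv nxt G t t"
  by (rule conv_par) simp

lemma conv_map:
  assumes "conv nxt G t u" and "\<And>t u. par nxt G t u \<Longrightarrow> conv nxt D (h t) (h u)"
  shows "conv nxt D (h t) (h u)"
  using assms
\<comment> \<open>The predicate for \<open>par\<close> is trivial, which leaves an induction over
  \<open>conv\<close> alone.\<close>
proof (induction rule: par_conv.inducts(2)[where ?P1.0 = "\<lambda>_ _ _. True"])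
  case (conv_sym G t u)
  then show ?case by (metis par_conv.conv_sym)
next
  case (conv_trans G t u v)
  then show ?case by (metis par_conv.conv_trans)
qed auto

lemma conv_app: "conv nxt G v v' \<Longrightarrow> conv nxt G t t' \<Longrightarrow> conv nxt G (PApp v t) (PApp v' t')"
  by (rule conv_trans[where u = "PApp v' t"]; erule conv_map) (simp_all add: conv_par par_app)

lemma conv_lam:
  "conv nxt G w w' \<Longrightarrow> conv nxt (ext w G) t t' \<Longrightarrow> conv nxt G (PLam w t) (PLam w' t')"
  by (rule conv_trans[where u = "PLam w t'"]; erule conv_map) (simp_all add: conv_par par_lam)

lemma par_conv_ren:
  shows par_ren: "par nxt G t t' \<Longrightarrow> \<forall>i. D (r i) = ren r (G i) \<Longrightarrow> par nxt D (ren r t) (ren r t')"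
    and conv_ren: "conv nxt G t t' \<Longrightarrow> \<forall>i. D (r i) = ren r (G i) \<Longrightarrow> conv nxt D (ren r t) (ren r t')"
proof (induction arbitrary: D r and D r rule: par_conv.inducts)
  case (par_eps G t u t')
  then show ?case by (metis ren.simps(5) ty_ren par_conv.par_eps)
next
  case (conv_trans G t u v)
  then show ?case by (metis par_conv.conv_trans)
next
  case (conv_sym G t u)
  then show ?case by (metis par_conv.conv_sym)
qed (auto intro: par_conv.intros simp: ext_ren ren_inst)

lemma conv_ren_Suc: "conv nxt G t u \<Longrightarrow> conv nxt (ext w G) (ren Suc t) (ren Suc u)"
  by (erule conv_ren) simp

lemma par_ren_Suc: "par nxt G t u \<Longrightarrow> par nxt (ext w G) (ren Suc t) (ren Suc u)"
  by (erule par_ren) simp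

lemma par_up: "\<forall>i. par nxt D (f i) (g i) \<Longrightarrow> \<forall>i. par nxt (ext w D) (up f i) (up g i)"
  by (subst all_nat_split) (simp add: par_ren_Suc)

text \<open>The typing condition falls on \<open>f\<close> because the side condition of
  \<open>par_eps\<close> concerns the source of a step, to which \<open>f\<close> is applied. For
  \<open>conv\<close>, a single step is mapped with \<open>g = f\<close>.\<close>

lemma par_conv_sub:
  shows par_sub: "par nxt G t t' \<Longrightarrow> \<forall>i. ty nxt (f i) D = sub f (G i) \<Longrightarrow>
      \<forall>i. par nxt D (f i) (g i) \<Longrightarrow> par nxt D (sub f t) (sub g t')"
    and conv_sub: "conv nxt G t t' \<Longrightarrow> \<forall>i. ty nxt (f i) D = sub f (G i) \<Longrightarrow>
      conv nxt D (sub f t) (sub f t')"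
proof (induction arbitrary: D f g and D f rule: par_conv.inducts)
  case (par_lam G w w' t t')
  then show ?case by (simp add: par_conv.par_lam ext_sub par_up)
next
  case (par_beta G v v' w w' t t')
  then show ?case by (simp add: par_conv.par_beta ext_sub par_up sub_inst)
next
  case (par_eps G t u t')
  then show ?case by (metis sub.simps(5) ty_sub par_conv.par_eps)
next
  case (conv_par G t u)
  then show ?case by (simp add: par_conv.conv_par)
next
  case (conv_trans G t u v)
  then show ?case by (metis par_conv.conv_trans)
next
  case (conv_sym G t u)
  then show ?case by (metis par_conv.conv_sym)
qed (auto intro: par_conv.intros)

lemma conv_ext: "\<forall>i. conv nxt D (G i) (D i) \<Longrightarrow> \<forall>i. conv nxt (ext w D) (ext w G i) (ext w D i)"
  by (subst all_nat_split) (simp add: conv_ren_Suc)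

lemma conv_ext_arg: "conv nxt G w' w \<Longrightarrow> \<forall>i. conv nxt (ext w G) (ext w' G i) (ext w G i)"
  by (subst all_nat_split) (simp add: conv_ren_Suc)

lemma ty_ctx_conv: "\<forall>i. conv nxt D (G i) (D i) \<Longrightarrow> conv nxt D (ty nxt t G) (ty nxt t D)"
  by (induction t arbitrary: D G) (simp_all add: conv_app conv_lam conv_ext)

text \<open>The context matters only through \<open>ty\<close> in the side condition of
  \<open>par_eps\<close>. By \<open>ty_ctx_conv\<close> that type changes up to conversion, and
  transitivity of \<open>conv\<close> absorbs the change.\<close>

lemma par_conv_ctx:
  shows par_ctx: "par nxt G t t' \<Longrightarrow> \<forall>i. conv nxt D (G i) (D i) \<Longrightarrow> par nxt D t t'"
    and conv_ctx: "conv nxt G t t' \<Longrightarrow> \<forall>i. conv nxt D (G i) (D i) \<Longrightarrow> conv nxt D t t'"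
proof (induction arbitrary: D and D rule: par_conv.inducts)
  case (par_eps G t u t')
  then show ?case
    by (metis par_conv.par_eps conv_sym conv_trans ty_ctx_conv)
next
  case (conv_trans G t u v)
  then show ?case by (metis par_conv.conv_trans)
next
  case (conv_sym G t u)
  then show ?case by (metis par_conv.conv_sym)
qed (auto intro: par_conv.intros simp: conv_ext)

text \<open>\<open>par_lam\<close> and \<open>par_beta\<close> reduce the body under the old
  annotation \<open>w\<close>; joining two such steps compares the bodies under the new annotation
  \<open>w'\<close>.\<close>

lemma par_ext: "par nxt (ext w G) t t' \<Longrightarrow> par nxt G w w' \<Longrightarrow> par nxt (ext w' G) t t'"
  by (erule par_ctx) (simp add: conv_ext_arg conv_par)

text \<open>This fails if casts may be erased unconditionally: the side condition of \<open>par_eps\<close> covers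
  that case, and the cast introduced by \<open>par_beta\<close> keeps the type of the bound variable.\<close>

lemma par_ty: "par nxt G t t' \<Longrightarrow> conv nxt G (ty nxt t G) (ty nxt t' G)"
proof (induction t arbitrary: G t')
  case (PSort s)
  then show ?case by (auto elim: par_sortE)
next
  case (PVar i)
  then show ?case by (auto elim: par_varE)
next
  case (PApp v t)
  from PApp.prems show ?case
  proof (rule par_appE)
    fix v' t'' assume "t' = PApp v' t''" "par nxt G v v'" "par nxt G t t''"
    then show ?thesis by (auto intro: conv_app conv_par PApp.IH)
  next
    fix v' w w' t0 t0'
    assume *: "t = PLam w t0" "t' = inst (PCast w' v') t0'"
      "par nxt G v v'" "par nxt G w w'" "par nxt (ext w G) t0 t0'"
    \<comment> \<open>The induction hypothesis is applied to the abstraction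
      \<open>PLam w' t0'\<close>, a \<open>par\<close> reduct of \<open>t\<close>, so it covers the
      change of annotation as well. Contracting the same redex inside the type then gives the type
      of the contractum.\<close>
    have "conv nxt G (ty nxt (PApp v t) G) (PApp v' (PLam w' (ty nxt t0' (ext w' G))))"
      using PApp.IH(2)[of G "PLam w' t0'"] * by (simp add: conv_app conv_par par_lam)
    also have "conv nxt G \<dots> (inst (PCast w' v') (ty nxt t0' (ext w' G)))"
      by (intro conv_par par_beta par_refl)
    finally show ?thesis using * by (simp add: ty_inst)
  qed
next
  case (PLam w t)
  from PLam.prems show ?case
  proof (rule par_lamE)
    fix w' t'' assume *: "t' = PLam w' t''" "par nxt G w w'" "par nxt (ext w G) t t''"
    have "conv nxt (ext w G) (ty nxt t (ext w G)) (ty nxt t'' (ext w G))"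
      using * by (intro PLam.IH)
    also have "conv nxt (ext w G) \<dots> (ty nxt t'' (ext w' G))"
      by (rule conv_sym, rule ty_ctx_conv) (rule conv_ext_arg, rule conv_sym, rule conv_par, rule *)
    finally show ?thesis using * by (simp add: conv_lam conv_par)
  qed
next
  case (PCast u t)
  from PCast.prems show ?case
    by (rule par_castE) (auto intro: conv_par conv_sym conv_trans PCast.IH)
qed

lemma conv_ty: "conv nxt G t t' \<Longrightarrow> conv nxt G (ty nxt t G) (ty nxt t' G)"
  by (erule conv_map) (rule par_ty)

text \<open>Takahashi's complete development, contracting exactly the redexes of \<open>par\<close>.\<close>

fun dev :: "('s \<Rightarrow> 's) \<Rightarrow> 's pterm \<Rightarrow> 's ctx \<Rightarrow> 's pterm" where
  "dev nxt (PSort s) G = PSort s"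
| "dev nxt (PVar i) G = PVar i"
| "dev nxt (PApp v (PLam w t)) G = inst (PCast (dev nxt w G) (dev nxt v G)) (dev nxt t (ext w G))"
| "dev nxt (PApp v t) G = PApp (dev nxt v G) (dev nxt t G)"
| "dev nxt (PLam w t) G = PLam (dev nxt w G) (dev nxt t (ext w G))"
| "dev nxt (PCast u t) G =
    (if conv nxt G (ty nxt t G) u then dev nxt t G else PCast (dev nxt u G) (dev nxt t G))"

text \<open>Triangle property. Beyond the usual cases, a cast may be erasable in \<open>t\<close>
  and yet kept in \<open>t'\<close>: then \<open>par_ty\<close> shows that the reduced cast is still
  erasable.\<close>

lemma par_dev: "par nxt G t t' \<Longrightarrow> par nxt G t' (dev nxt t G)"
proof (induction nxt t G arbitrary: t' rule: dev.induct)
  case (3 nxt v w t G)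
  from "3.prems" show ?case
  proof (rule par_appE)
    fix v' x assume "t' = PApp v' x" "par nxt G v v'" "par nxt G (PLam w t) x"
    then show ?thesis
      by (auto elim!: par_lamE intro!: par_beta "3.IH" intro: par_ext)
  next
    fix v' w1 w' t1 t''
    assume *: "PLam w t = PLam w1 t1" "t' = inst (PCast w' v') t''"
      "par nxt G v v'" "par nxt G w1 w'" "par nxt (ext w1 G) t1 t''"
    \<comment> \<open>The body is moved to the context with \<open>w'\<close>, because the term
      substituted into it is \<open>PCast w' v'\<close>, whose type is exactly
      \<open>w'\<close>.\<close>
    then have "par nxt (ext w' G) t'' (dev nxt t (ext w G))"
      using "3.IH"(3)[of t''] by (auto intro: par_ext)
    moreover have "par nxt G (PCast w' v') (PCast (dev nxt w G) (dev nxt v G))"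
      using * by (intro par_cast "3.IH") simp_all
    then have "\<forall>i. par nxt G (scons (PCast w' v') PVar i)
        (scons (PCast (dev nxt w G) (dev nxt v G)) PVar i)"
      by (subst all_nat_split) simp
    ultimately have "par nxt G (inst (PCast w' v') t'')
        (inst (PCast (dev nxt w G) (dev nxt v G)) (dev nxt t (ext w G)))"
      by (intro par_sub[where G = "ext w' G"] ext_inst) simp_all
    with * show ?thesis by simp
  qed
next
  case (5 nxt w t G)
  then show ?case by (auto elim!: par_lamE intro!: par_lam intro: par_ext)
next
  case (6 nxt u t G)
  show ?case
  proof (cases "conv nxt G (ty nxt t G) u")
    case True
    from "6.prems" show ?thesis
    proof (rule par_castE)
      fix u' t'' assume *: "t' = PCast u' t''" "par nxt G u u'" "par nxt G t t''"
      have "conv nxt G (ty nxt t'' G) u'"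
        using * True by (blast intro: conv_sym conv_trans conv_par par_ty)
      with * True show ?thesis by (auto intro: par_eps "6.IH")
    qed (simp add: True "6.IH")
  next
    case False
    with "6.prems" show ?thesis by (auto elim!: par_castE intro!: par_cast "6.IH")
  qed
qed (erule par_sortE par_varE par_appE; simp add: par_sort par_var par_app)+

section \<open>Confluence and the Church-Rosser property\<close>

abbreviation pars :: "('s \<Rightarrow> 's) \<Rightarrow> 's ctx \<Rightarrow> 's pterm \<Rightarrow> 's pterm \<Rightarrow> bool" where
  "pars nxt G \<equiv> (par nxt G)\<^sup>*\<^sup>*"

lemma confluentp_par: "confluentp (par nxt G)"
  by (intro strong_confluentp_imp_confluentp strong_confluentpI) (blast intro: par_dev)

text \<open>Although \<open>conv\<close> also occurs inside \<open>par\<close>, from outside it is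
  just the equivalence generated by \<open>par\<close>, so the usual derivation of joinability from
  confluence applies.\<close>

theorem conv_joinable: "conv nxt G t u \<Longrightarrow> \<exists>x. pars nxt G t x \<and> pars nxt G u x"
proof (induction rule: par_conv.inducts(2)[where ?P1.0 = "\<lambda>_ _ _. True"])
  case (conv_trans G t u v)
  then obtain x y where "pars nxt G t x" "pars nxt G u x" "pars nxt G u y" "pars nxt G v y"
    by blast
  moreover from this obtain z where "pars nxt G x z" "pars nxt G y z"
    using confluentpD[OF confluentp_par] by blast
  ultimately show ?case by (blast intro: rtranclp_trans)
qed blast+

lemma conv_pars: "pars nxt G t u \<Longrightarrow> conv nxt G t u"
  by (induction rule: rtranclp_induct) (auto intro: conv_par conv_trans)

lemma pars_lam: "pars nxt G (PLam w t) x \<Longrightarrow> \<exists>w' t'. x = PLam w' t' \<and> pars nxt G w w'"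
proof (induction rule: rtranclp_induct)
  case (step x y)
  then obtain w' t' where "x = PLam w' t'" "pars nxt G w w'" by blast
  with step.hyps(2) show ?case by (auto elim!: par_lamE intro: rtranclp.rtrancl_into_rtrancl)
qed simp

text \<open>Injectivity of abstraction in its annotation. In subject reduction it matches the
  annotation of a beta redex with the type of the argument.\<close>

lemma conv_lam_arg:
  assumes "conv nxt G (PLam w t) (PLam w' t')"
  shows "conv nxt G w w'"
proof -
  obtain x where "pars nxt G (PLam w t) x" "pars nxt G (PLam w' t') x"
    using conv_joinable[OF assms] by blast
  then obtain v where "pars nxt G w v" "pars nxt G w' v"
    by (auto dest!: pars_lam)
  then show ?thesis by (blast intro: conv_pars conv_sym conv_trans)
qed

section \<open>Well-typed pure terms\<close>

abbreviation tyn :: "('s \<Rightarrow> 's) \<Rightarrow> nat \<Rightarrow> 's pterm \<Rightarrow> 's ctx \<Rightarrow> 's pterm" where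
  "tyn nxt n t G \<equiv> ((\<lambda>t. ty nxt t G) ^^ n) t"

lemma tyn_lam: "tyn nxt n (PLam w t) G = PLam w (tyn nxt n t (ext w G))"
  by (induction n) simp_all

lemma tyn_ren: "\<forall>i. D (r i) = ren r (G i) \<Longrightarrow> tyn nxt n (ren r t) D = ren r (tyn nxt n t G)"
  by (induction n) (simp_all add: ty_ren[where G = G])

lemma tyn_sub:
  "\<forall>i. ty nxt (f i) D = sub f (G i) \<Longrightarrow> tyn nxt n (sub f t) D = sub f (tyn nxt n t G)"
  by (induction n) (simp_all add: ty_sub[where G = G])

lemma conv_tyn: "conv nxt G t t' \<Longrightarrow> conv nxt G (tyn nxt n t G) (tyn nxt n t' G)"
  by (induction n) (simp_all add: conv_ty)

lemma tyn_ctx_conv: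
  "\<forall>i. conv nxt D (G i) (D i) \<Longrightarrow> conv nxt D (tyn nxt n t G) (tyn nxt n t D)"
proof (induction n)
  case (Suc n)
  then show ?case using conv_trans[OF ty_ctx_conv conv_ty] by simp
qed simp

text \<open>The exponent \<open>n\<close> in \<open>wt_app\<close> ranges over all naturals because
  a typed step of the function may lower it. The junk entry of an undeclared variable is that
  variable itself, so \<open>wt_var\<close> never derives it.\<close>

inductive wt :: "('s \<Rightarrow> 's) \<Rightarrow> 's ctx \<Rightarrow> 's pterm \<Rightarrow> bool"
  for nxt :: "'s \<Rightarrow> 's" where
  wt_sort: "wt nxt G (PSort s)"
| wt_var: "wt nxt G (G i) \<Longrightarrow> wt nxt G (PVar i)"
| wt_lam: "wt nxt G w \<Longrightarrow> wt nxt (ext w G) t \<Longrightarrow> wt nxt G (PLam w t)"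
| wt_cast: "wt nxt G u \<Longrightarrow> wt nxt G t \<Longrightarrow> conv nxt G (ty nxt t G) u \<Longrightarrow> wt nxt G (PCast u t)"
| wt_app: "wt nxt G v \<Longrightarrow> wt nxt G t \<Longrightarrow> conv nxt G (tyn nxt n t G) (PLam w u)
    \<Longrightarrow> conv nxt G (ty nxt v G) w \<Longrightarrow> wt nxt G (PApp v t)"

inductive_cases wt_varE: "wt nxt G (PVar i)"
inductive_cases wt_lamE: "wt nxt G (PLam w t)"
inductive_cases wt_castE: "wt nxt G (PCast u t)"
inductive_cases wt_appE: "wt nxt G (PApp v t)"

lemma wt_ren: "wt nxt G t \<Longrightarrow> \<forall>i. D (r i) = ren r (G i) \<Longrightarrow> wt nxt D (ren r t)"
proof (induction arbitrary: D r rule: wt.induct)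
  case (wt_cast G u t)
  then show ?case using conv_ren[OF wt_cast.hyps(3), of D r]
    by (simp add: wt.wt_cast ty_ren[where G = G])
next
  case (wt_app G v t n w u)
  have "conv nxt D (tyn nxt n (ren r t) D) (PLam (ren r w) (ren (up_ren r) u))"
    using conv_ren[OF wt_app.hyps(3), of D r] wt_app.prems by (simp add: tyn_ren[where G = G])
  moreover have "conv nxt D (ty nxt (ren r v) D) (ren r w)"
    using conv_ren[OF wt_app.hyps(4), of D r] wt_app.prems by (simp add: ty_ren[where G = G])
  ultimately show ?case using wt_app.IH wt_app.prems by (simp add: wt.wt_app)
qed (simp_all add: wt.intros ext_ren)

lemma wt_ren_Suc: "wt nxt G t \<Longrightarrow> wt nxt (ext w G) (ren Suc t)"
  by (erule wt_ren) simp

text \<open>If \<open>f i\<close> is a variable \<open>PVar j\<close>, its well-typedness comes from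
  the induction hypothesis for \<open>G i\<close>, since \<open>sub f (G i)\<close> is
  \<open>D j\<close>. This admits instantiations, which fix variables that may be
  undeclared.\<close>

lemma wt_sub:
  "wt nxt G t \<Longrightarrow> \<forall>i. ty nxt (f i) D = sub f (G i) \<Longrightarrow>
    \<forall>i. (\<exists>j. f i = PVar j) \<or> wt nxt D (f i) \<Longrightarrow> wt nxt D (sub f t)"
proof (induction arbitrary: D f rule: wt.induct)
  case (wt_var G i)
  then have "wt nxt D (ty nxt (f i) D)" by simp
  with wt_var.prems(2) show ?case by (metis sub.simps(2) ty.simps(2) wt.wt_var)
next
  case (wt_lam G w t)
  have "\<forall>i. (\<exists>j. up f i = PVar j) \<or> wt nxt (ext (sub f w) D) (up f i)"
    using wt_lam.prems(2) by (subst all_nat_split) (metis ren.simps(2) up_0 up_Suc wt_ren_Suc)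
  then show ?case using wt_lam by (simp add: wt.wt_lam ext_sub)
next
  case (wt_cast G u t)
  then show ?case using conv_sub[OF wt_cast.hyps(3), of f D]
    by (simp add: wt.wt_cast ty_sub[where G = G])
next
  case (wt_app G v t n w u)
  have "conv nxt D (tyn nxt n (sub f t) D) (PLam (sub f w) (sub (up f) u))"
    using conv_sub[OF wt_app.hyps(3), of f D] wt_app.prems by (simp add: tyn_sub[where G = G])
  moreover have "conv nxt D (ty nxt (sub f v) D) (sub f w)"
    using conv_sub[OF wt_app.hyps(4), of f D] wt_app.prems by (simp add: ty_sub[where G = G])
  ultimately show ?case using wt_app.IH wt_app.prems by (simp add: wt.wt_app)
qed (simp add: wt.wt_sort)

lemma wt_inst:
  assumes "wt nxt (ext w G) t" "wt nxt G a" "ty nxt a G = w"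
  shows "wt nxt G (inst a t)"
  using assms(1) ext_inst[OF assms(3)]
  by (rule wt_sub) (subst all_nat_split, simp add: assms(2))

text \<open>For an unchanged entry, well-typedness in \<open>D\<close> comes from the induction
  hypothesis for \<open>G i\<close>; for a changed one it is assumed.\<close>

lemma wt_ctx:
  "wt nxt G t \<Longrightarrow> \<forall>i. conv nxt D (G i) (D i) \<Longrightarrow> \<forall>i. D i = G i \<or> wt nxt D (D i) \<Longrightarrow> wt nxt D t"
proof (induction arbitrary: D rule: wt.induct)
  case (wt_var G i)
  then show ?case by (metis wt.wt_var)
next
  case (wt_lam G w t)
  have "\<forall>i. ext w D i = ext w G i \<or> wt nxt (ext w D) (ext w D i)"
    using wt_lam.prems(2) by (subst all_nat_split) (metis ext_0 ext_Suc wt_ren_Suc)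
  then show ?case using wt_lam by (simp add: wt.wt_lam conv_ext)
next
  case (wt_cast G u t)
  have "conv nxt D (ty nxt t D) u"
    using wt_cast.prems wt_cast.hyps by (metis conv_ctx conv_sym conv_trans ty_ctx_conv)
  with wt_cast show ?case by (simp add: wt.wt_cast)
next
  case (wt_app G v t n w u)
  have "conv nxt D (tyn nxt n t D) (PLam w u)"
    using conv_trans[OF conv_sym[OF tyn_ctx_conv] conv_ctx[OF wt_app.hyps(3)]] wt_app.prems by simp
  moreover have "conv nxt D (ty nxt v D) w"
    using conv_trans[OF conv_sym[OF ty_ctx_conv] conv_ctx[OF wt_app.hyps(4)]] wt_app.prems by simp
  ultimately show ?case using wt_app by (simp add: wt.wt_app)
qed (simp add: wt.wt_sort)

lemma wt_ext:
  assumes "wt nxt (ext w G) t" "wt nxt G w'" "conv nxt G w w'"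
  shows "wt nxt (ext w' G) t"
  using assms(1) conv_ext_arg[OF assms(3)]
  by (rule wt_ctx) (subst all_nat_split, simp add: wt_ren_Suc assms(2))

section \<open>Unrestricted reduction and typed steps on pure terms\<close>

inductive red :: "'s pterm \<Rightarrow> 's pterm \<Rightarrow> bool" where
  red_beta: "red (PApp v (PLam w t)) (inst (PCast w v) t)"
| red_eps: "red (PCast u t) t"
| red_app_arg: "red v v' \<Longrightarrow> red (PApp v t) (PApp v' t)"
| red_app_fun: "red t t' \<Longrightarrow> red (PApp v t) (PApp v t')"
| red_lam_arg: "red w w' \<Longrightarrow> red (PLam w t) (PLam w' t)"
| red_lam_body: "red t t' \<Longrightarrow> red (PLam w t) (PLam w t')"
| red_cast_ty: "red u u' \<Longrightarrow> red (PCast u t) (PCast u' t)"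
| red_cast_tm: "red t t' \<Longrightarrow> red (PCast u t) (PCast u t')"

inductive tstep :: "('s \<Rightarrow> 's) \<Rightarrow> 's ctx \<Rightarrow> 's pterm \<Rightarrow> 's pterm \<Rightarrow> bool"
  for nxt :: "'s \<Rightarrow> 's" where
  tstep_sort: "tstep nxt G (PSort s) (PSort (nxt s))"
| tstep_var: "tstep nxt G (PVar i) (G i)"
| tstep_ety: "tstep nxt G (PCast u t) u"
| tstep_app: "tstep nxt G t t' \<Longrightarrow> tstep nxt G (PApp v t) (PApp v t')"
| tstep_lam: "tstep nxt (ext w G) t t' \<Longrightarrow> tstep nxt G (PLam w t) (PLam w t')"
| tstep_cast: "tstep nxt G u u' \<Longrightarrow> tstep nxt G t t' \<Longrightarrow> tstep nxt G (PCast u t) (PCast u' t')"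

text \<open>Erasing a cast is a \<open>par\<close> step because \<open>wt_cast\<close> records the
  side condition. Both conclusions go through one induction: the \<open>par\<close> step of a
  subterm transports the conversions that \<open>wt_app\<close> and \<open>wt_cast\<close>
  require.\<close>

theorem wt_red: "red t t' \<Longrightarrow> wt nxt G t \<Longrightarrow> par nxt G t t' \<and> wt nxt G t'"
proof (induction arbitrary: G rule: red.induct)
  case (red_beta v w t)
  from red_beta.prems show ?case
  proof (rule wt_appE)
    fix n w0 u0
    assume *: "wt nxt G v" "wt nxt G (PLam w t)" "conv nxt G (ty nxt v G) w0"
      and "conv nxt G (tyn nxt n (PLam w t) G) (PLam w0 u0)"
    \<comment> \<open>Every iterate of \<open>ty\<close> on an abstraction keeps its annotation
      \<open>w\<close>.\<close>
    then have "conv nxt G w w0" by (simp add: tyn_lam conv_lam_arg)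
    with * have "wt nxt G (PCast w v)"
      by (blast intro: wt_cast conv_sym conv_trans elim: wt_lamE)
    moreover have "wt nxt (ext w G) t" using * by (auto elim: wt_lamE)
    ultimately show ?thesis by (simp add: wt_inst par_beta)
  qed
next
  case (red_eps u t)
  then show ?case by (auto elim!: wt_castE intro: par_eps)
next
  case (red_app_arg v v' t)
  from red_app_arg.prems show ?case
  proof (rule wt_appE)
    fix n w u
    assume *: "wt nxt G v" "wt nxt G t" "conv nxt G (tyn nxt n t G) (PLam w u)"
      "conv nxt G (ty nxt v G) w"
    then have "par nxt G v v'" "wt nxt G v'" by (simp_all add: red_app_arg.IH)
    moreover from this have "conv nxt G (ty nxt v' G) w"
      using * by (blast intro: conv_trans conv_sym par_ty)
    ultimately show ?thesis using * by (auto intro: wt_app par_app)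
  qed
next
  case (red_app_fun t t' v)
  from red_app_fun.prems show ?case
  proof (rule wt_appE)
    fix n w u
    assume *: "wt nxt G v" "wt nxt G t" "conv nxt G (tyn nxt n t G) (PLam w u)"
      "conv nxt G (ty nxt v G) w"
    then have "par nxt G t t'" "wt nxt G t'" by (simp_all add: red_app_fun.IH)
    moreover from this have "conv nxt G (tyn nxt n t' G) (PLam w u)"
      using * by (blast intro: conv_trans conv_sym conv_tyn conv_par)
    ultimately show ?thesis using * by (auto intro: wt_app par_app)
  qed
next
  case (red_lam_arg w w' t)
  then show ?case by (auto elim!: wt_lamE intro!: par_lam wt_lam intro: wt_ext conv_par)
next
  case (red_lam_body t t' w)
  then show ?case by (auto elim!: wt_lamE intro!: par_lam wt_lam)
next
  case (red_cast_ty u u' t)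
  then show ?case by (auto elim!: wt_castE intro!: par_cast wt_cast intro: conv_par conv_trans)
next
  case (red_cast_tm t t' u)
  then have *: "wt nxt G u" "par nxt G t t'" "wt nxt G t'" "conv nxt G (ty nxt t G) u"
    by (auto elim!: wt_castE)
  from conv_sym[OF par_ty[OF *(2)]] *(4) have "conv nxt G (ty nxt t' G) u"
    by (rule conv_trans)
  with * show ?case by (simp add: par_cast wt_cast)
qed

lemma tstep_ren:
  "tstep nxt G t t' \<Longrightarrow> \<forall>i. D (r i) = ren r (G i) \<Longrightarrow> tstep nxt D (ren r t) (ren r t')"
proof (induction arbitrary: D r rule: tstep.induct)
  case (tstep_var G i)
  then show ?case by (metis ren.simps(2) tstep.tstep_var)
qed (auto intro: tstep.intros simp: ext_ren)

lemma tstep_ren_Suc: "tstep nxt G t t' \<Longrightarrow> tstep nxt (ext w G) (ren Suc t) (ren Suc t')"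
  by (erule tstep_ren) simp

text \<open>The step and \<open>ty\<close> differ at casts, where \<open>tstep_cast\<close> keeps
  the cast while \<open>ty\<close> returns the annotation; well-typedness makes the two results
  convertible.\<close>

theorem wt_tstep: "tstep nxt G t t' \<Longrightarrow> wt nxt G t \<Longrightarrow> conv nxt G (ty nxt t G) t' \<and> wt nxt G t'"
proof (induction rule: tstep.induct)
  case (tstep_app G t t' v)
  from tstep_app.prems show ?case
  proof (rule wt_appE)
    fix n w u
    assume *: "wt nxt G v" "wt nxt G t" "conv nxt G (tyn nxt n t G) (PLam w u)"
      "conv nxt G (ty nxt v G) w"
    then have t': "conv nxt G (ty nxt t G) t'" "wt nxt G t'" by (simp_all add: tstep_app.IH)
    \<comment> \<open>For \<open>n = 0\<close> the term \<open>t\<close> converts to an abstraction,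
      hence so does its type, with the same annotation. For larger \<open>n\<close> the step uses up
      one iterate.\<close>
    have "\<exists>m u. conv nxt G (tyn nxt m t' G) (PLam w u)"
    proof (cases n)
      case 0
      then have "conv nxt G t' (PLam w (ty nxt u (ext w G)))"
        using * conv_ty[of nxt G t "PLam w u"] t' by (auto intro: conv_trans conv_sym)
      then have "conv nxt G (tyn nxt 0 t' G) (PLam w (ty nxt u (ext w G)))" by simp
      then show ?thesis by blast
    next
      case (Suc m)
      then have "conv nxt G (tyn nxt m (ty nxt t G) G) (PLam w u)"
        using *(3) by (simp add: funpow_Suc_right del: funpow.simps(2))
      then show ?thesis using conv_tyn[OF t'(1)] by (blast intro: conv_trans conv_sym)
    qed
    with * t' show ?thesis by (auto intro: wt_app conv_app)
  qed
next
  case (tstep_lam w G t t')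
  then show ?case by (auto elim!: wt_lamE intro!: wt_lam conv_lam)
next
  case (tstep_cast G u u' t t')
  from tstep_cast.prems have *: "wt nxt G u" "wt nxt G t" "conv nxt G (ty nxt t G) u"
    by (auto elim: wt_castE)
  then have IH: "conv nxt G (ty nxt u G) u'" "conv nxt G (ty nxt t G) t'" "wt nxt G u'" "wt nxt G t'"
    using tstep_cast.IH by blast+
  \<comment> \<open>As \<open>t'\<close> converts to \<open>u\<close>, its type converts to that of
    \<open>u\<close>, hence to \<open>u'\<close>. So \<open>PCast u' t'\<close> is erasable and
    converts to \<open>t'\<close>, and thus to \<open>u\<close>.\<close>
  have "conv nxt G t' u" using IH(2) *(3) by (blast intro: conv_trans conv_sym)
  then have "conv nxt G (ty nxt t' G) u'" using IH(1) by (blast intro: conv_trans conv_ty)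
  moreover from this have "conv nxt G (PCast u' t') t'" by (rule conv_par[OF par_eps[OF _ par_refl]])
  ultimately show ?case using IH \<open>conv nxt G t' u\<close> by (auto intro: wt_cast conv_trans conv_sym)
qed (auto intro: wt_sort elim: wt_varE wt_castE)

abbreviation reds :: "'s pterm \<Rightarrow> 's pterm \<Rightarrow> bool" where
  "reds \<equiv> red\<^sup>*\<^sup>*"

lemma wt_reds: "reds t t' \<Longrightarrow> wt nxt G t \<Longrightarrow> conv nxt G t t' \<and> wt nxt G t'"
  by (induction rule: rtranclp_induct) (auto dest: wt_red intro: conv_par conv_trans)

lemma reds_map: "reds t u \<Longrightarrow> (\<And>t u. red t u \<Longrightarrow> red (h t) (h u)) \<Longrightarrow> reds (h t) (h u)"
  by (induction rule: rtranclp_induct) (auto intro: rtranclp.rtrancl_into_rtrancl)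

lemma reds_app: "reds v v' \<Longrightarrow> reds t t' \<Longrightarrow> reds (PApp v t) (PApp v' t')"
  by (rule rtranclp_trans[where y = "PApp v' t"]; erule reds_map) (auto intro: red.intros)

lemma reds_lam: "reds v v' \<Longrightarrow> reds t t' \<Longrightarrow> reds (PLam v t) (PLam v' t')"
  by (rule rtranclp_trans[where y = "PLam v' t"]; erule reds_map) (auto intro: red.intros)

lemma reds_cast: "reds v v' \<Longrightarrow> reds t t' \<Longrightarrow> reds (PCast v t) (PCast v' t')"
  by (rule rtranclp_trans[where y = "PCast v' t"]; erule reds_map) (auto intro: red.intros)

lemma red_ren: "red t t' \<Longrightarrow> red (ren r t) (ren r t')"
  by (induction arbitrary: r rule: red.induct) (auto intro: red.intros simp: ren_inst)

lemma reds_ren: "reds t t' \<Longrightarrow> reds (ren r t) (ren r t')"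
  by (erule reds_map) (rule red_ren)

section \<open>Unfolding definitions\<close>

text \<open>A definition leaves no binder behind, so \<open>delta\<close>, \<open>zeta\<close> and
  \<open>theta\<close> steps at the root become identities.\<close>

primrec unfold :: "'s trm \<Rightarrow> (nat \<Rightarrow> 's pterm) \<Rightarrow> 's pterm" where
  "unfold (Sort s) f = PSort s"
| "unfold (Var i) f = f i"
| "unfold (App V T) f = PApp (unfold V f) (unfold T f)"
| "unfold (Bind b V T) f =
    (case b of Lam \<Rightarrow> PLam (unfold V f) (unfold T (up f)) | Def \<Rightarrow> unfold T (scons (unfold V f) f))"
| "unfold (Cast U T) f = PCast (unfold U f) (unfold T f)"

lemma unfold_lift: "unfold (lift k T) f = unfold T (\<lambda>i. f (if i < k then i else Suc i))"
proof (induction T arbitrary: k f)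
  case (Bind b V T)
  have "(\<lambda>i. up f (if i < Suc k then i else Suc i)) = up (\<lambda>i. f (if i < k then i else Suc i))"
    and "(\<lambda>i. scons a f (if i < Suc k then i else Suc i)) =
      scons a (\<lambda>i. f (if i < k then i else Suc i))" for a
    by (simp_all add: fun_eq_nat_split)
  with Bind show ?case by (simp split: bkind.split)
qed auto

lemma unfold_lift_0 [simp]: "unfold (lift 0 T) f = unfold T (\<lambda>i. f (Suc i))"
  by (simp add: unfold_lift)

lemma ren_unfold: "ren r (unfold T f) = unfold T (\<lambda>i. ren r (f i))"
proof (induction T arbitrary: r f)
  case (Bind b V T)
  have "(\<lambda>i. ren (up_ren r) (up f i)) = up (\<lambda>i. ren r (f i))"
    and "(\<lambda>i. ren r (scons a f i)) = scons (ren r a) (\<lambda>i. ren r (f i))" for a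
    by (simp_all add: fun_eq_nat_split up_ren_Suc)
  with Bind show ?case by (simp split: bkind.split)
qed auto

lemma sub_unfold: "sub g (unfold T f) = unfold T (\<lambda>i. sub g (f i))"
proof (induction T arbitrary: g f)
  case (Bind b V T)
  have "(\<lambda>i. sub (up g) (up f i)) = up (\<lambda>i. sub g (f i))"
    and "(\<lambda>i. sub g (scons a f i)) = scons (sub g a) (\<lambda>i. sub g (f i))" for a
    by (simp_all add: fun_eq_nat_split sub_up_ren_Suc)
  with Bind show ?case by (simp split: bkind.split)
qed auto

lemma inst_unfold_up: "inst a (unfold T (up f)) = unfold T (scons a f)"
  unfolding sub_unfold
  by (rule arg_cong[where f = "unfold T"]) (simp add: fun_eq_nat_split)

text \<open>A step in the value of a definition is repeated at each of its occurrences, so it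
  unfolds to any number of steps, possibly none.\<close>

lemma reds_unfold: "\<forall>i. reds (f i) (g i) \<Longrightarrow> reds (unfold T f) (unfold T g)"
proof (induction T arbitrary: f g)
  case (Bind b V T)
  from Bind.prems have "\<forall>i. reds (up f i) (up g i)"
    by (subst all_nat_split) (simp add: reds_ren)
  moreover from Bind have "\<forall>i. reds (scons (unfold V f) f i) (scons (unfold V g) g i)"
    by (subst all_nat_split) simp
  ultimately show ?case using Bind by (simp add: reds_lam split: bkind.split)
qed (auto simp: reds_app reds_cast)

section \<open>Environments and soundness of the translation\<close>

fun env_sub :: "'s env \<Rightarrow> nat \<Rightarrow> 's pterm" where
  "env_sub [] = PVar"
| "env_sub ((Lam, W) # K) = up (env_sub K)"
| "env_sub ((Def, V) # K) = scons (unfold V (env_sub K)) (env_sub K)"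

text \<open>Definitions occupy no slot in the context. The undeclared variables get a junk type.\<close>

fun env_ctx :: "'s env \<Rightarrow> 's ctx" where
  "env_ctx [] = PVar"
| "env_ctx ((Lam, W) # K) = ext (unfold W (env_sub K)) (env_ctx K)"
| "env_ctx ((Def, V) # K) = env_ctx K"

lemma unfold_lift_Lam:
  "unfold (lift 0 T) (env_sub ((Lam, W) # K)) = ren Suc (unfold T (env_sub K))"
  by (simp add: ren_unfold)

lemma rt_step_reds:
  "rt_step nxt L n T T' \<Longrightarrow> n = 0 \<Longrightarrow> reds (unfold T (env_sub L)) (unfold T' (env_sub L))"
proof (induction rule: rt_step.induct)
  case (beta L V W T)
  show ?case by (auto intro!: r_into_rtranclp red_beta simp flip: inst_unfold_up)
next
  case (var K n i T b V)
  show ?case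
  proof (cases b)
    case Lam
    have "reds (env_sub K i) (unfold T (env_sub K))" using var by simp
    then have "reds (ren Suc (env_sub K i)) (ren Suc (unfold T (env_sub K)))" by (rule reds_ren)
    then show ?thesis unfolding Lam unfold_lift_Lam by simp
  next
    case Def
    with var show ?thesis by simp
  qed
next
  case (bind_arg L V1 V2 b T)
  then have "\<forall>i. reds (scons (unfold V1 (env_sub L)) (env_sub L) i)
      (scons (unfold V2 (env_sub L)) (env_sub L) i)"
    by (subst all_nat_split) simp
  with bind_arg show ?case by (auto simp: reds_lam reds_unfold split: bkind.split)
next
  case (bind_body b V L n T1 T2)
  then show ?case by (cases b) (auto simp: reds_lam)
qed (auto intro: reds_app reds_cast red_eps)

lemma rt_step_tstep:
  "rt_step nxt L n T T' \<Longrightarrow> n \<noteq> 0 \<Longrightarrow>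
    tstep nxt (env_ctx L) (unfold T (env_sub L)) (unfold T' (env_sub L))"
proof (induction rule: rt_step.induct)
  case (sort L s)
  show ?case by (simp add: tstep_sort)
next
  case (decl W K)
  show ?case
    using tstep_var[of nxt "env_ctx ((Lam, W) # K)" 0]
    unfolding unfold_lift_Lam by simp
next
  case (ety L U T)
  show ?case by (simp add: tstep_ety)
next
  case (var K n i T b V)
  show ?case
  proof (cases b)
    case Lam
    have "tstep nxt (env_ctx K) (env_sub K i) (unfold T (env_sub K))" using var by simp
    then have "tstep nxt (env_ctx ((Lam, V) # K)) (ren Suc (env_sub K i)) (ren Suc (unfold T (env_sub K)))"
      unfolding env_ctx.simps by (rule tstep_ren_Suc)
    then show ?thesis unfolding Lam unfold_lift_Lam by simp
  next
    case Def
    with var show ?thesis by simp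
  qed
next
  case (app_fun L n T1 T2 V)
  then show ?case by (simp add: tstep_app)
next
  case (bind_body b V L n T1 T2)
  then show ?case by (cases b) (simp_all add: tstep_lam)
next
  case (cast_both L U1 U2 T1 T2)
  then show ?case by (simp add: tstep_cast)
qed simp_all

abbreviation wt_in :: "('s \<Rightarrow> 's) \<Rightarrow> 's env \<Rightarrow> 's trm \<Rightarrow> bool" where
  "wt_in nxt L T \<equiv> wt nxt (env_ctx L) (unfold T (env_sub L))"

lemma rt_step_degree: "rt_step nxt L n T T' \<Longrightarrow> n = 0 \<or> n = 1"
  by (induction rule: rt_step.induct) auto

text \<open>Steps of degree 0 stay within conversion and steps of degree 1 apply \<open>ty\<close>
  up to conversion; \<open>conv_tyn\<close> lets the iterates compose.\<close>

theorem rt_steps_sound: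
  "rt_steps nxt L n T T' \<Longrightarrow> wt_in nxt L T \<Longrightarrow>
    conv nxt (env_ctx L) (tyn nxt n (unfold T (env_sub L)) (env_ctx L)) (unfold T' (env_sub L))
    \<and> wt_in nxt L T'"
proof (induction rule: rt_steps.induct)
  case (step L n T1 T2)
  from rt_step_degree[OF step.hyps] show ?case
  proof
    assume "n = 0"
    then show ?thesis using wt_reds[OF rt_step_reds[OF step.hyps] step.prems] by simp
  next
    assume "n = 1"
    then show ?thesis using wt_tstep[OF rt_step_tstep[OF step.hyps] step.prems] by simp
  qed
next
  case (trans L n1 T1 T n2 T2)
  let ?u = "\<lambda>T. unfold T (env_sub L)" and ?G = "env_ctx L"
  from trans have *: "conv nxt ?G (tyn nxt n1 (?u T1) ?G) (?u T)" "wt_in nxt L T"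
    "conv nxt ?G (tyn nxt n2 (?u T) ?G) (?u T2)" "wt_in nxt L T2"
    by blast+
  from conv_tyn[OF *(1), of n2] *(3)
  have "conv nxt ?G (tyn nxt n2 (tyn nxt n1 (?u T1) ?G) ?G) (?u T2)" by (rule conv_trans)
  with *(4) show ?case by (simp add: funpow_add add.commute[of n1])
qed simp

text \<open>The induction hypotheses supply the well-typedness that \<open>rt_steps_sound\<close>
  asks for; it then turns the reductions demanded by \<open>cast\<close> and \<open>app\<close> into
  the conversions of \<open>wt_cast\<close> and \<open>wt_app\<close>.\<close>

theorem valid_wt: "valid nxt A L T \<Longrightarrow> wt_in nxt L T"
proof (induction rule: valid.induct)
  case (sort L s)
  then show ?case by (simp add: wt_sort)
next
  case (var_0 K V b)
  then show ?case by (cases b) (auto intro!: wt_var wt_ren_Suc)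
next
  case (var_Suc K i b V)
  then show ?case by (cases b) (auto intro!: wt_ren_Suc)
next
  case (bind L V b T)
  then show ?case by (cases b) (auto intro: wt_lam)
next
  case (cast L U T U0)
  let ?u = "\<lambda>T. unfold T (env_sub L)" and ?G = "env_ctx L"
  have "conv nxt ?G (ty nxt (?u T) ?G) (?u U0)" and "conv nxt ?G (?u U) (?u U0)"
    using rt_steps_sound[OF cast.hyps(3)] rt_steps_sound[OF cast.hyps(4)] cast.IH by simp_all
  then have "conv nxt ?G (ty nxt (?u T) ?G) (?u U)" by (blast intro: conv_trans conv_sym)
  with cast.IH show ?case by (simp add: wt_cast)
next
  case (app L V T n W0 U0)
  then show ?case
    using rt_steps_sound[OF app.hyps(4)] rt_steps_sound[OF app.hyps(5)]
    by (auto intro: wt_app)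
qed

section \<open>Normal forms\<close>

fun is_def :: "'s env \<Rightarrow> nat \<Rightarrow> bool" where
  "is_def [] = (\<lambda>i. False)"
| "is_def ((b, V) # K) = scons (b = Def) (is_def K)"

text \<open>The shape that r-normality enforces, with \<open>d\<close> marking the defined
  variables. An application whose function part is a binder is a \<open>beta\<close> or
  \<open>theta\<close> redex.\<close>

primrec nf :: "'s trm \<Rightarrow> (nat \<Rightarrow> bool) \<Rightarrow> bool" where
  "nf (Sort s) d \<longleftrightarrow> True"
| "nf (Var i) d \<longleftrightarrow> \<not> d i"
| "nf (App V T) d \<longleftrightarrow> nf V d \<and> nf T d \<and> (\<forall>b W U. T \<noteq> Bind b W U)"
| "nf (Bind b V T) d \<longleftrightarrow> b = Lam \<and> nf V d \<and> nf T (scons False d)"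
| "nf (Cast U T) d \<longleftrightarrow> False"

lemma rt_steps0_trans:
  "rt_steps nxt L 0 T U \<Longrightarrow> rt_steps nxt L 0 U V \<Longrightarrow> rt_steps nxt L 0 T V"
  using rt_steps.trans[of nxt L 0 T U 0 V] by simp

lemma rt_steps_map:
  assumes "rt_steps nxt L n T U" and "n = 0"
    and "\<And>T U. rt_step nxt L 0 T U \<Longrightarrow> rt_step nxt M 0 (h T) (h U)"
  shows "rt_steps nxt M 0 (h T) (h U)"
  using assms
proof (induction rule: rt_steps.induct)
  case (trans L n1 T1 T n2 T2)
  then show ?case by (auto intro: rt_steps0_trans)
qed (auto intro: rt_steps.intros)

lemma rt_steps_app:
  "rt_steps nxt L 0 V V' \<Longrightarrow> rt_steps nxt L 0 T T' \<Longrightarrow> rt_steps nxt L 0 (App V T) (App V' T')"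
  by (rule rt_steps0_trans[where U = "App V' T"]; erule rt_steps_map)
    (auto intro: rt_step.app_arg rt_step.app_fun)

lemma rt_steps_cast:
  "rt_steps nxt L 0 V V' \<Longrightarrow> rt_steps nxt L 0 T T' \<Longrightarrow> rt_steps nxt L 0 (Cast V T) (Cast V' T')"
  by (rule rt_steps0_trans[where U = "Cast V' T"]; erule rt_steps_map)
    (auto intro: rt_step.cast_ty rt_step.cast_tm)

lemma rt_steps_bind:
  "rt_steps nxt L 0 V V' \<Longrightarrow> rt_steps nxt ((b, V') # L) 0 T T' \<Longrightarrow>
    rt_steps nxt L 0 (Bind b V T) (Bind b V' T')"
  by (rule rt_steps0_trans[where U = "Bind b V' T"]; erule rt_steps_map)
    (auto intro: rt_step.bind_arg rt_step.bind_body)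

lemma lift_lift: "i \<le> k \<Longrightarrow> lift i (lift k T) = lift (Suc k) (lift i T)"
  by (induction T arbitrary: i k) auto

lemma size_lift [simp]: "size (lift k T) = size T"
  by (induction T arbitrary: k) auto

lemma rt_step_delta_append:
  "\<exists>T. rt_step nxt (M @ (Def, V) # L) 0 (Var (length M)) (lift (length M) T)"
proof (induction M)
  case Nil
  then show ?case by (auto intro: rt_step.delta)
next
  case (Cons e M)
  then obtain T where "rt_step nxt (M @ (Def, V) # L) 0 (Var (length M)) (lift (length M) T)"
    by blast
  from rt_step.var[OF this, of "fst e" "snd e"] show ?case
    by (intro exI[of _ "lift 0 T"]) (simp add: lift_lift)
qed

text \<open>Unfolding every occurrence of the defined variable makes it disappear, which prepares a
  \<open>zeta\<close> step. The prefix \<open>M\<close> collects the binders passed on the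
  way.\<close>

lemma rt_steps_delta_all:
  "\<exists>T'. rt_steps nxt (M @ (Def, V) # L) 0 T (lift (length M) T')"
proof (induction T arbitrary: M)
  case (Sort s)
  show ?case by (rule exI[of _ "Sort s"]) (simp add: rt_steps.refl)
next
  case (Var i)
  consider "i < length M" | "i = length M" | j where "i = Suc j" "length M \<le> j"
    by (metis less_Suc_eq_le linorder_neqE_nat not0_implies_Suc not_less0)
  then show ?case
  proof cases
    case 1
    then show ?thesis by (intro exI[of _ "Var i"]) (simp add: rt_steps.refl)
  next
    case 2
    then show ?thesis using rt_step_delta_append by (blast intro: rt_steps.step)
  next
    case 3
    then show ?thesis by (intro exI[of _ "Var j"]) (simp add: rt_steps.refl)
  qed
next
  case (App V' T)
  obtain V1 T1 where "rt_steps nxt (M @ (Def, V) # L) 0 V' (lift (length M) V1)"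
    "rt_steps nxt (M @ (Def, V) # L) 0 T (lift (length M) T1)"
    using App.IH by blast
  then show ?case by (intro exI[of _ "App V1 T1"]) (simp add: rt_steps_app)
next
  case (Bind b W T)
  obtain W1 where "rt_steps nxt (M @ (Def, V) # L) 0 W (lift (length M) W1)"
    using Bind.IH(1) by blast
  \<comment> \<open>The body is treated under the annotation already reduced, as
    \<open>rt_steps_bind\<close> reduces the annotation first.\<close>
  moreover obtain T1 where "rt_steps nxt ((b, lift (length M) W1) # M @ (Def, V) # L) 0 T
      (lift (Suc (length M)) T1)"
    using Bind.IH(2)[of "(b, lift (length M) W1) # M"] by auto
  ultimately show ?case by (intro exI[of _ "Bind b W1 T1"]) (simp add: rt_steps_bind)
next
  case (Cast V' T)
  obtain V1 T1 where "rt_steps nxt (M @ (Def, V) # L) 0 V' (lift (length M) V1)"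
    "rt_steps nxt (M @ (Def, V) # L) 0 T (lift (length M) T1)"
    using Cast.IH by blast
  then show ?case by (intro exI[of _ "Cast V1 T1"]) (simp add: rt_steps_cast)
qed

text \<open>After \<open>delta\<close> steps at all occurrences, \<open>zeta\<close> removes the
  definition. Normality would identify the terms before and after \<open>zeta\<close>, but their
  sizes differ.\<close>

lemma not_r_normal_Def: "\<not> r_normal nxt L (Bind Def V T)"
proof
  assume nf: "r_normal nxt L (Bind Def V T)"
  obtain T' where "rt_steps nxt ((Def, V) # L) 0 T (lift 0 T')"
    using rt_steps_delta_all[of nxt "[]" V L T] by auto
  then have *: "rt_steps nxt L 0 (Bind Def V T) (Bind Def V (lift 0 T'))"
    by (intro rt_steps_bind rt_steps.refl)
  moreover from * have "rt_steps nxt L 0 (Bind Def V T) T'"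
    by (rule rt_steps0_trans) (intro rt_steps.step rt_step.zeta)
  ultimately have "Bind Def V (lift 0 T') = T'"
    using nf[unfolded r_normal_def, rule_format, of "Bind Def V (lift 0 T')"]
      nf[unfolded r_normal_def, rule_format, of T'] by metis
  then have "size (Bind Def V (lift 0 T')) = size T'" by simp
  then show False by simp
qed

text \<open>That the reduct differs from the variable is part of the claim because
  \<open>r_normal\<close> tolerates steps from a term to itself.\<close>

lemma rt_step_is_def: "is_def L i \<Longrightarrow> \<exists>T. rt_step nxt L 0 (Var i) T \<and> T \<noteq> Var i"
proof (induction L arbitrary: i)
  case (Cons e K)
  obtain b V where e: "e = (b, V)" by (cases e)
  show ?case
  proof (cases i)
    case 0
    with Cons.prems e have "b = Def" by simp
    moreover have "lift 0 V \<noteq> Var 0" by (cases V) auto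
    ultimately show ?thesis using e 0 by (auto intro: rt_step.delta)
  next
    case (Suc j)
    with Cons e obtain T where "rt_step nxt K 0 (Var j) T" "T \<noteq> Var j" by auto
    moreover from this have "lift 0 T \<noteq> Var (Suc j)" by (cases T) auto
    ultimately show ?thesis using e Suc by (auto intro: rt_step.var)
  qed
qed simp

lemma r_normalD: "r_normal nxt L T \<Longrightarrow> rt_step nxt L 0 T T' \<Longrightarrow> T' = T"
  by (simp add: r_normal_def rt_steps.step)

text \<open>Injectivity of \<open>h\<close> turns the equation \<open>h T' = h T\<close>, given by
  normality of \<open>h T\<close>, into \<open>T' = T\<close>.\<close>

lemma r_normal_map:
  assumes "r_normal nxt L (h T)" and "inj h"
    and "\<And>T U. rt_step nxt M 0 T U \<Longrightarrow> rt_step nxt L 0 (h T) (h U)"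
  shows "r_normal nxt M T"
  using assms rt_steps_map[of nxt M 0 T _ L h] by (auto simp: r_normal_def inj_def)

lemma r_normal_nf: "r_normal nxt L T \<Longrightarrow> nf T (is_def L)"
proof (induction T arbitrary: L)
  case (Var i)
  then show ?case using rt_step_is_def r_normalD by fastforce
next
  case (App V T)
  from App.prems have "r_normal nxt L V"
    by (rule r_normal_map[where h = "\<lambda>V. App V T"]) (auto simp: inj_def intro: rt_step.app_arg)
  moreover from App.prems have "r_normal nxt L T"
    by (rule r_normal_map[where h = "App V"]) (auto simp: inj_def intro: rt_step.app_fun)
  moreover have "T \<noteq> Bind b W U" for b W U
    using r_normalD[OF App.prems] rt_step.beta[of nxt L V W U] rt_step.theta[of nxt L V W U]
    by (cases b) auto
  ultimately show ?case using App.IH by simp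
next
  case (Bind b V T)
  have "b = Lam" using Bind.prems not_r_normal_Def by (cases b) auto
  moreover from Bind.prems have "r_normal nxt L V"
    by (rule r_normal_map[where h = "\<lambda>V. Bind b V T"]) (auto simp: inj_def intro: rt_step.bind_arg)
  moreover from Bind.prems have "r_normal nxt ((b, V) # L) T"
    by (rule r_normal_map[where h = "Bind b V"]) (auto simp: inj_def intro: rt_step.bind_body)
  then have "nf T (is_def ((b, V) # L))" by (rule Bind.IH)
  ultimately show ?case using Bind.IH by simp
next
  case (Cast U T)
  have "T = Cast U T" using Cast.prems rt_step.eps by (rule r_normalD)
  then have "size T = size (Cast U T)" by simp
  then show ?case by simp
qed simp

text \<open>The condition is imposed off \<open>d\<close> because on a term with
  \<open>nf T d\<close> these are the only indices at which \<open>unfold\<close> consults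
  \<open>f\<close>.\<close>

definition injective_renaming :: "(nat \<Rightarrow> bool) \<Rightarrow> (nat \<Rightarrow> 's pterm) \<Rightarrow> bool" where
  "injective_renaming d f \<longleftrightarrow> (\<forall>i. \<not> d i \<longrightarrow> (\<exists>j. f i = PVar j)) \<and> inj_on f {i. \<not> d i}"

lemma injective_renaming_up:
  assumes "injective_renaming d f"
  shows "injective_renaming (scons False d) (up f)"
proof -
  from assms obtain g where g: "\<And>i. \<not> d i \<Longrightarrow> f i = PVar (g i)"
    unfolding injective_renaming_def by metis
  have inj: "i = j" if "\<not> d i" "\<not> d j" "g i = g j" for i j
    using assms that g[OF that(1)] g[OF that(2)]
    by (simp add: injective_renaming_def inj_on_def)
  have up: "up f i = PVar (up_ren g i)" if "\<not> scons False d i" for i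
    using that by (cases i) (simp_all add: g)
  have "i = j" if "\<not> scons False d i" "\<not> scons False d j" "up_ren g i = up_ren g j" for i j
    using that by (cases i; cases j) (simp_all add: inj)
  then show ?thesis
    by (auto simp: injective_renaming_def inj_on_def up)
qed

lemma injective_renaming_env: "injective_renaming (is_def L) (env_sub L)"
proof (induction L rule: env_sub.induct)
  case (3 V K)
  \<comment> \<open>Index 0 is the definition itself, so all other indices are successors and the
    claim is inherited from \<open>K\<close>.\<close>
  have "\<exists>k. i = Suc k \<and> \<not> is_def K k" if "\<not> scons True (is_def K) i" for i
    using that by (cases i) auto
  with 3 show ?case unfolding injective_renaming_def inj_on_def
    by simp (metis scons.simps(2))
qed (simp_all add: injective_renaming_up, simp add: injective_renaming_def inj_on_def)

text \<open>On normal terms \<open>unfold\<close> translates constructor by constructor and renames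
  variables injectively, so it can be inverted.\<close>

lemma unfold_nf_inj:
  "nf T d \<Longrightarrow> nf T' d \<Longrightarrow> injective_renaming d f \<Longrightarrow> unfold T f = unfold T' f \<Longrightarrow> T = T'"
proof (induction T arbitrary: T' d f)
  case (Sort s)
  then show ?case by (cases T') (auto simp: injective_renaming_def)
next
  case (Var i)
  then have "\<not> d i" by simp
  with Var.prems(3) obtain j where "f i = PVar j" by (auto simp: injective_renaming_def)
  with Var show ?case by (cases T') (auto simp: injective_renaming_def inj_on_def)
next
  case (App V T)
  then show ?case by (cases T') (auto simp: injective_renaming_def)
next
  case (Bind b V T)
  then obtain W U where T': "T' = Bind Lam W U"
    by (cases T') (auto simp: injective_renaming_def)
  with Bind.prems show ?case
    using Bind.IH(1)[of d W f] Bind.IH(2)[OF _ _ injective_renaming_up, of d U f] by simp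
qed simp

text \<open>\<open>par_eps\<close> finds no cast. \<open>par_beta\<close> finds no redex: the
  function part is not a binder, and a variable outside \<open>d\<close> unfolds to a variable, so
  neither yields an abstraction.\<close>

lemma par_nf:
  "nf T d \<Longrightarrow> injective_renaming d f \<Longrightarrow> par nxt G (unfold T f) t \<Longrightarrow> t = unfold T f"
proof (induction T arbitrary: d f G t)
  case (Sort s)
  then show ?case by (auto elim: par_sortE)
next
  case (Var i)
  then obtain j where "f i = PVar j" by (auto simp: injective_renaming_def)
  with Var.prems(3) show ?case by (auto elim: par_varE)
next
  case (App V T)
  have "unfold T f \<noteq> PLam w u" for w u
    using App.prems by (cases T) (auto simp: injective_renaming_def)
  moreover from App.prems(3) have "par nxt G (PApp (unfold V f) (unfold T f)) t" by simp
  then have "(\<exists>v' t'. t = PApp v' t' \<and> par nxt G (unfold V f) v' \<and> par nxt G (unfold T f) t')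
      \<or> (\<exists>w u. unfold T f = PLam w u)"
    by (rule par_appE) simp_all
  ultimately obtain v' t' where "t = PApp v' t'" "par nxt G (unfold V f) v'"
    "par nxt G (unfold T f) t'"
    by auto
  moreover from this have "v' = unfold V f" "t' = unfold T f"
    using App.prems(1,2) by (auto intro: App.IH)
  ultimately show ?case by simp
next
  case (Bind b V T)
  then show ?case by (auto elim!: par_lamE dest: injective_renaming_up)
qed simp

lemma pars_nf:
  "pars nxt G (unfold T f) t \<Longrightarrow> nf T d \<Longrightarrow> injective_renaming d f \<Longrightarrow> t = unfold T f"
  by (induction rule: rtranclp_induct) (auto dest: par_nf)

theorem theorem5p2:
  fixes nxt :: "'s \<Rightarrow> 's" and A :: "nat set" and n :: nat
    and L :: "'s env" and T T1 T2 :: "'s trm"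
  assumes "valid nxt A L T"
    and "rt_steps nxt L n T T1" and "r_normal nxt L T1"
    and "rt_steps nxt L n T T2" and "r_normal nxt L T2"
  shows "T1 = T2"
proof -
  have "conv nxt (env_ctx L) (unfold T1 (env_sub L)) (unfold T2 (env_sub L))"
    using rt_steps_sound[OF assms(2)] rt_steps_sound[OF assms(4)] valid_wt[OF assms(1)]
    by (blast intro: conv_trans conv_sym)
  then obtain x where "pars nxt (env_ctx L) (unfold T1 (env_sub L)) x"
    and "pars nxt (env_ctx L) (unfold T2 (env_sub L)) x"
    using conv_joinable by blast
  \<comment> \<open>Both unfoldings admit only trivial \<open>par\<close> steps, so each of them
    equals the common reduct \<open>x\<close>.\<close>
  then have "unfold T1 (env_sub L) = unfold T2 (env_sub L)"
    using pars_nf[OF _ r_normal_nf injective_renaming_env] assms(3,5) by metis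
  with r_normal_nf[OF assms(3)] r_normal_nf[OF assms(5)] injective_renaming_env show ?thesis
    by (rule unfold_nf_inj)
qed

end
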